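(* Let $p\in\mathbb{N}^*$, $r\in\mathbb{K}^*$, $a,c\in\ell(\mathbb{K}^*;p,r)$, $b\in\ell(\mathbb{K};p,r)$. Put $s=\prod_{j=0}^{p-1}\frac{a(j)}{c(j)}$ and $\gamma=(\sqrt{rs})^{-1}$. Then there exists a number $q_{p,r}(a;b;c)\in\mathbb{C}$ (depending only on $p,r,a,b,c$ and the chosen square root $\sqrt{rs}$) such that for every solution $z\in\ell(\mathbb{K})$ of the equation $$a(k)z(k+1)-b(k)z(k)+c(k-1)z(k-1)=0,\qquad k\in\mathbb{Z},$$ and every $m\in\mathbb{Z}$ one has $z_{p,m}(k)=\gamma^{k}v(k)$ for all $k\in\mathbb{Z}$, where the sequence $v\in\ell(\mathbb{C})$ is a solution of the Chebyshev equation $$v(k+1)-2q_{p,r}(a;b;c)\,v(k)+v(k-1)=0,\qquad k\in\mathbb{Z}.$$ Moreover, if $\mathbb{K}=\mathbb{R}$: (i) If $rs>0$, then $q_{p,r}(a;b;c)\in\mathbb{R}$ and $v\in\ell(\mathbb{R})$. (ii) If $rs<0$, then $q_{p,r}(a;b;c)^2\in\mathbb{R}$ and $z_{2p,m}(k)=(rs)^{-k}u(k)$ for all $k\in\mathbb{Z}$, where $u\in\ell(\mathbb{R})$ is a solution of the Chebyshev equation $$u(k+1)-2\big(2q_{p,r}(a;b;c)^2-1\big)u(k)+u(k-1)=0,\qquad k\in\mathbb{Z}.$$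
   Context: $\mathbb{K}$ denotes either $\mathbb{R}$ or $\mathbb{C}$, $\mathbb{K}^*=\mathbb{K}\setminus\{0\}$, $\mathbb{N}^*=\{1,2,3,\dots\}$. $\ell(\mathbb{K})$ is the space of all functions (sequences) $z:\mathbb{Z}\to\mathbb{K}$, and $\ell(\mathbb{K}^* )$ is the subset of sequences with $z(k)\neq 0$ for all $k\in\mathbb{Z}$. For $p\in\mathbb{N}^*$ and $r\in\mathbb{K}^*$, $\ell(\mathbb{K};p,r)$ is the set of quasi-periodic sequences with period $p$ and ratio $r$, i.e. $z\in\ell(\mathbb{K})$ with $z(k+p)=r\,z(k)$ for all $k\in\mathbb{Z}$; $\ell(\mathbb{K}^*;p,r)=\ell(\mathbb{K};p,r)\cap\ell(\mathbb{K}^* )$. For $z\in\ell(\mathbb{K})$, $p\in\mathbb{N}^*$ and $m\in\mathbb{Z}$, the subsequence $z_{p,m}$ is defined by $z_{p,m}(k)=z(kp+m)$, $k\in\mathbb{Z}$. The symbol $\sqrt{rs}$ denotes a fixed complex square root of $rs$. The Chebyshev equation with parameter $q$ is $z(k+1)-2qz(k)+z(k-1)=0$, $k\in\mathbb{Z}$. *)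

theory Defs
  imports Complex_Main
begin

text \<open>
  The scalar field is a set \<open>K\<close> of complex numbers, to be taken as \<open>\<real>\<close> or \<open>UNIV\<close>, so that the
  real and the complex case share one complex square root of \<open>r * s\<close> and one parameter \<open>q\<close>.
  The sequences with values in \<open>K\<close> and without zeros are \<open>ell (K - {0})\<close>.
\<close>

definition ell :: "complex set \<Rightarrow> (int \<Rightarrow> complex) set" where
  "ell K = {z. \<forall>k. z k \<in> K}"

definition ell_qp :: "complex set \<Rightarrow> nat \<Rightarrow> complex \<Rightarrow> (int \<Rightarrow> complex) set" where
  "ell_qp K p r = {z \<in> ell K. \<forall>k. z (k + int p) = r * z k}"

definition subsequence :: "(int \<Rightarrow> complex) \<Rightarrow> nat \<Rightarrow> int \<Rightarrow> (int \<Rightarrow> complex)" where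
  "subsequence z p m = (\<lambda>k. z (k * int p + m))"

definition solves_recurrence ::
    "(int \<Rightarrow> complex) \<Rightarrow> (int \<Rightarrow> complex) \<Rightarrow> (int \<Rightarrow> complex) \<Rightarrow> (int \<Rightarrow> complex) \<Rightarrow> bool" where
  "solves_recurrence a b c z \<longleftrightarrow>
     (\<forall>k. a k * z (k + 1) - b k * z k + c (k - 1) * z (k - 1) = 0)"

definition solves_chebyshev :: "complex \<Rightarrow> (int \<Rightarrow> complex) \<Rightarrow> bool" where
  "solves_chebyshev q z \<longleftrightarrow> (\<forall>k. z (k + 1) - 2 * q * z k + z (k - 1) = 0)"

end

theory Submission
  imports Defs
begin

text \<open>
  This is Floquet theory for a second-order recurrence. Since \<open>a\<close>, \<open>b\<close> and \<open>c\<close> all pick up the same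
  factor \<open>r\<close> under the shift by \<open>p\<close>, that shift is a linear operator on the two-dimensional space of
  solutions. By Cayley--Hamilton it satisfies \<open>S\<^sup>2 - T S + D = 0\<close>, with \<open>T\<close> its trace and \<open>D\<close> its
  determinant, that is, \<open>z (j + 2 p) - T z (j + p) + D z j = 0\<close> for every solution \<open>z\<close> and every \<open>j\<close>
  (\<open>period_shift_relation\<close>). As this holds at every position \<open>j\<close>, the same numbers serve all residues
  \<open>m\<close>.

  The determinant is the value at \<open>p\<close> of the Casoratian of the fundamental solutions. It
  telescopes to a product (\<open>casoratian_product\<close>), which the quasi-periodicity of \<open>a\<close> turns into
  \<open>D = 1 / (r s)\<close> (\<open>casoratian_period\<close>). Rescaling the subsequence by \<open>\<sigma>\<close>, where \<open>\<sigma>\<^sup>2 = r s\<close>, makes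
  the determinant one, and what remains is the Chebyshev equation with \<open>2 q = \<sigma> T\<close>
  (\<open>rescaled_chebyshev\<close>).

  For real coefficients \<open>T\<close> is real. Hence \<open>q\<close> is real when \<open>\<sigma>\<close> is, and \<open>q\<^sup>2 = r s T\<^sup>2 / 4\<close> is real in
  any case; when \<open>r s < 0\<close>, passing to every second term (\<open>chebyshev_double\<close>) replaces the
  imaginary scaling factor \<open>\<sigma>\<close> by the real one \<open>\<sigma>\<^sup>2 = r s\<close>.
\<close>

section \<open>Solutions and their initial values\<close>

text \<open>
  The solution with initial values \<open>x\<close> and \<open>y\<close>, on the half-line only: this determines the action
  of the period shift, and there only division by \<open>a\<close> occurs.
\<close>

fun forward_sol ::
    "(int \<Rightarrow> complex) \<Rightarrow> (int \<Rightarrow> complex) \<Rightarrow> (int \<Rightarrow> complex) \<Rightarrow> complex \<Rightarrow> complex \<Rightarrow> nat \<Rightarrow> complex" where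
  "forward_sol a b c x y 0 = x"
| "forward_sol a b c x y (Suc 0) = y"
| "forward_sol a b c x y (Suc (Suc n)) =
     (b (int n + 1) * forward_sol a b c x y (Suc n) - c (int n) * forward_sol a b c x y n)
       / a (int n + 1)"

lemma forward_sol_real:
  assumes "\<And>k. a k \<in> \<real>" "\<And>k. b k \<in> \<real>" "\<And>k. c k \<in> \<real>" "x \<in> \<real>" "y \<in> \<real>"
  shows "forward_sol a b c x y n \<in> \<real>"
proof (induction n rule: induct_nat_012)
  case (ge2 n)
  then show ?case
    using assms by (simp del: of_nat_Suc)
qed (use assms in simp_all)

lemma solves_recurrence_step:
  assumes "solves_recurrence a b c z" and "a (k + 1) \<noteq> 0"
  shows "z (k + 2) = (b (k + 1) * z (k + 1) - c k * z k) / a (k + 1)"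
proof -
  have "a (k + 1) * z (k + 1 + 1) - b (k + 1) * z (k + 1) + c (k + 1 - 1) * z (k + 1 - 1) = 0"
    using assms(1) unfolding solves_recurrence_def by blast
  then have "a (k + 1) * z (k + 2) = b (k + 1) * z (k + 1) - c k * z k"
    by (simp add: algebra_simps)
  then show ?thesis
    using assms(2) by (simp add: field_simps)
qed

lemma solution_superposition:
  assumes sol: "solves_recurrence a b c z" and nz: "\<And>k. a k \<noteq> 0"
  shows "z (int n) = z 0 * forward_sol a b c 1 0 n + z 1 * forward_sol a b c 0 1 n"
proof (induction n rule: induct_nat_012)
  case (ge2 n)
  have "z (int (Suc (Suc n))) = z (int n + 2)"
    by (simp add: algebra_simps)
  also have "\<dots> = (b (int n + 1) * z (int n + 1) - c (int n) * z (int n)) / a (int n + 1)"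
    by (rule solves_recurrence_step[OF sol nz])
  also have "z (int n + 1) =
      z 0 * forward_sol a b c 1 0 (Suc n) + z 1 * forward_sol a b c 0 1 (Suc n)"
    using ge2(2) by (simp add: algebra_simps)
  also note ge2(1)
  finally show ?case
    by (simp add: add_divide_distrib diff_divide_distrib algebra_simps)
qed auto

lemma solution_eq_zero:
  assumes sol: "solves_recurrence a b c w" and nz: "\<And>k. a k \<noteq> 0" "\<And>k. c k \<noteq> 0"
    and init: "w 0 = 0" "w 1 = 0"
  shows "w k = 0"
proof -
  have rec: "a k * w (k + 1) - b k * w k + c (k - 1) * w (k - 1) = 0" for k
    using sol unfolding solves_recurrence_def by blast
  have "w k = 0 \<and> w (k + 1) = 0"
  proof (induction k rule: int_induct[where k = 0])
    case (step1 i)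
    then show ?case
      using rec[of "i + 1"] nz(1)[of "i + 1"] by simp
  next
    case (step2 i)
    then show ?case
      using rec[of i] nz(2)[of "i - 1"] by simp
  qed (use init in auto)
  then show ?thesis ..
qed

section \<open>The period shift on the solution space\<close>

lemma solves_recurrence_period_shift:
  assumes sol: "solves_recurrence a b c z" and r: "r \<noteq> 0"
    and a: "a \<in> ell_qp A p r" and b: "b \<in> ell_qp B p r" and c: "c \<in> ell_qp C p r"
  shows "solves_recurrence a b c (\<lambda>k. z (k + int p))"
  unfolding solves_recurrence_def
proof
  fix k
  have "a (k + int p) * z (k + int p + 1) - b (k + int p) * z (k + int p)
      + c (k + int p - 1) * z (k + int p - 1) = 0"
    using sol unfolding solves_recurrence_def by blast
  moreover have "a (k + int p) = r * a k" "b (k + int p) = r * b k"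
    using a b by (auto simp: ell_qp_def)
  moreover have "c (k + int p - 1) = r * c (k - 1)"
  proof -
    have "c ((k - 1) + int p) = r * c (k - 1)"
      using c by (auto simp: ell_qp_def)
    then show ?thesis
      by (simp add: algebra_simps)
  qed
  ultimately have "r * (a k * z (k + int p + 1) - b k * z (k + int p)
      + c (k - 1) * z (k + int p - 1)) = 0"
    by (simp add: algebra_simps)
  then have "a k * z (k + int p + 1) - b k * z (k + int p) + c (k - 1) * z (k + int p - 1) = 0"
    using r by simp
  then show "a k * z (k + 1 + int p) - b k * z (k + int p) + c (k - 1) * z (k - 1 + int p) = 0"
    by (simp add: algebra_simps)
qed

definition monodromy_trace ::
    "(int \<Rightarrow> complex) \<Rightarrow> (int \<Rightarrow> complex) \<Rightarrow> (int \<Rightarrow> complex) \<Rightarrow> nat \<Rightarrow> complex" where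
  "monodromy_trace a b c p = forward_sol a b c 1 0 p + forward_sol a b c 0 1 (Suc p)"

definition casoratian ::
    "(int \<Rightarrow> complex) \<Rightarrow> (int \<Rightarrow> complex) \<Rightarrow> (int \<Rightarrow> complex) \<Rightarrow> nat \<Rightarrow> complex" where
  "casoratian a b c n =
     forward_sol a b c 1 0 n * forward_sol a b c 0 1 (Suc n)
     - forward_sol a b c 1 0 (Suc n) * forward_sol a b c 0 1 n"

lemma casoratian_product:
  assumes nz: "\<And>k. a k \<noteq> 0"
  shows "casoratian a b c n = (\<Prod>j = 0..<n. c (int j) / a (int j + 1))"
proof (induction n)
  case (Suc n)
  have "casoratian a b c (Suc n) = casoratian a b c n * (c (int n) / a (int n + 1))"
    using nz[of "int n + 1"] by (simp add: casoratian_def field_simps)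
  then show ?case
    using Suc.IH by simp
qed (simp add: casoratian_def)

text \<open>
  The product for the Casoratian runs over \<open>a 1, \<dots>, a p\<close> instead of \<open>a 0, \<dots>, a (p - 1)\<close>.
  Replacing \<open>a p = r * a 0\<close> by \<open>a 0\<close> accounts for the factor \<open>r\<close> beside \<open>s\<close>.
\<close>

lemma casoratian_period:
  assumes a: "a \<in> ell_qp A p r" and nz: "\<And>k. a k \<noteq> 0" "\<And>k. c k \<noteq> 0"
    and r: "r \<noteq> 0"
  shows "r * (\<Prod>j = 0..<p. a (int j) / c (int j)) * casoratian a b c p = 1"
proof -
  have ap: "a (int p) = r * a 0"
  proof -
    have "a (0 + int p) = r * a 0"
      using a unfolding ell_qp_def by blast
    then show ?thesis by simp
  qed
  have "a 0 * (\<Prod>j = 0..<p. a (int j + 1)) = (\<Prod>j = 0..<Suc p. a (int j))"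
    by (subst prod.atLeast0_lessThan_Suc_shift) (simp add: add.commute)
  also have "\<dots> = (\<Prod>j = 0..<p. a (int j)) * (r * a 0)"
    by (simp add: ap)
  finally have shift: "(\<Prod>j = 0..<p. a (int j + 1)) = r * (\<Prod>j = 0..<p. a (int j))"
    using nz(1)[of 0] by (simp add: mult.commute mult.left_commute)
  have "(\<Prod>j = 0..<p. a (int j)) \<noteq> 0" "(\<Prod>j = 0..<p. c (int j)) \<noteq> 0"
    using nz by simp_all
  then show ?thesis
    unfolding casoratian_product[where b = b, OF nz(1)]
    using r by (simp add: prod_dividef shift)
qed

text \<open>
  Cayley--Hamilton for the period shift. The left-hand side is, as a function of \<open>j\<close>, itself a
  solution, so it suffices that it vanishes at \<open>0\<close> and \<open>1\<close>. There it does because the vectors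
  \<open>(z 0, z 1)\<close>, \<open>(z p, z (p + 1))\<close> and \<open>(z (2 p), z (2 p + 1))\<close> arise from one another by the same
  two-by-two matrix.
\<close>

lemma period_shift_relation:
  assumes sol: "solves_recurrence a b c z"
    and a: "a \<in> ell_qp A p r" and b: "b \<in> ell_qp B p r" and c: "c \<in> ell_qp C p r"
    and nz: "\<And>k. a k \<noteq> 0" "\<And>k. c k \<noteq> 0" "r \<noteq> 0"
  shows "z (j + 2 * int p) - monodromy_trace a b c p * z (j + int p)
           + casoratian a b c p * z j = 0"
proof -
  define T D where "T = monodromy_trace a b c p" and "D = casoratian a b c p"
  define w where "w = (\<lambda>k. z (k + int p + int p) - T * z (k + int p) + D * z k)"
  have sol1: "solves_recurrence a b c (\<lambda>k. z (k + int p))"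
    by (rule solves_recurrence_period_shift[OF sol nz(3) a b c])
  have sol2: "solves_recurrence a b c (\<lambda>k. z (k + int p + int p))"
    by (rule solves_recurrence_period_shift[OF sol1 nz(3) a b c])
  have solw: "solves_recurrence a b c w"
    unfolding solves_recurrence_def
  proof
    fix k
    have "a k * w (k + 1) - b k * w k + c (k - 1) * w (k - 1) =
        (a k * z (k + 1 + int p + int p) - b k * z (k + int p + int p)
           + c (k - 1) * z (k - 1 + int p + int p))
        - T * (a k * z (k + 1 + int p) - b k * z (k + int p) + c (k - 1) * z (k - 1 + int p))
        + D * (a k * z (k + 1) - b k * z k + c (k - 1) * z (k - 1))"
      unfolding w_def by (simp only: algebra_simps)
    then show "a k * w (k + 1) - b k * w k + c (k - 1) * w (k - 1) = 0"
      using sol sol1 sol2 unfolding solves_recurrence_def by simp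
  qed
  note rep = solution_superposition[OF sol nz(1)]
  note rep1 = solution_superposition[OF sol1 nz(1)]
  have z1: "z (int p) = z 0 * forward_sol a b c 1 0 p + z 1 * forward_sol a b c 0 1 p"
    "z (1 + int p) = z 0 * forward_sol a b c 1 0 (Suc p) + z 1 * forward_sol a b c 0 1 (Suc p)"
    using rep[of p] rep[of "Suc p"] by simp_all
  have z2: "z (int p + int p) =
      z (int p) * forward_sol a b c 1 0 p + z (1 + int p) * forward_sol a b c 0 1 p"
    "z (1 + int p + int p) =
      z (int p) * forward_sol a b c 1 0 (Suc p) + z (1 + int p) * forward_sol a b c 0 1 (Suc p)"
    using rep1[of p] rep1[of "Suc p"] by simp_all
  have "w 0 = z (int p + int p) - T * z (int p) + D * z 0"
    "w 1 = z (1 + int p + int p) - T * z (1 + int p) + D * z 1"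
    by (simp_all add: w_def)
  then have "w 0 = 0" "w 1 = 0"
    unfolding z2 unfolding z1 unfolding T_def D_def monodromy_trace_def casoratian_def
    by (simp_all only:, simp_all only: algebra_simps)
       (simp_all del: forward_sol.simps)
  then have "w j = 0"
    by (rule solution_eq_zero[OF solw nz(1,2)])
  then show ?thesis
    by (simp add: w_def T_def D_def algebra_simps)
qed

section \<open>Chebyshev equations\<close>

lemma rescaled_chebyshev:
  fixes z :: "int \<Rightarrow> complex" and \<sigma> T D :: complex
  assumes rel: "\<And>j. z (j + 2 * int p) - T * z (j + int p) + D * z j = 0"
    and D: "\<sigma>\<^sup>2 * D = 1"
  shows "solves_chebyshev (\<sigma> * T / 2) (\<lambda>k. \<sigma> powi k * z (k * int p + m))"
  unfolding solves_chebyshev_def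
proof
  fix k
  define j where "j = (k - 1) * int p + m"
  have nz: "\<sigma> \<noteq> 0"
    using D by auto
  have idx: "(k + 1) * int p + m = j + 2 * int p" "k * int p + m = j + int p"
    by (simp_all add: j_def algebra_simps)
  have pow: "\<sigma> powi (k + 1) = \<sigma> powi (k - 1) * \<sigma>\<^sup>2" "\<sigma> powi k = \<sigma> powi (k - 1) * \<sigma>"
    using power_int_add[of \<sigma> "k - 1" 2] power_int_add[of \<sigma> "k - 1" 1] nz
    by (simp_all add: add.commute)
  have "\<sigma> powi (k + 1) * z (j + 2 * int p) - 2 * (\<sigma> * T / 2) * (\<sigma> powi k * z (j + int p))
      + \<sigma> powi (k - 1) * z j
    = \<sigma> powi (k - 1) * (\<sigma>\<^sup>2 * (z (j + 2 * int p) - T * z (j + int p)) + z j)"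
    unfolding pow by (simp add: algebra_simps power2_eq_square)
  also have "\<sigma>\<^sup>2 * (z (j + 2 * int p) - T * z (j + int p)) + z j =
      \<sigma>\<^sup>2 * (z (j + 2 * int p) - T * z (j + int p) + D * z j)"
    using D by (simp add: algebra_simps)
  finally show "\<sigma> powi (k + 1) * z ((k + 1) * int p + m)
      - 2 * (\<sigma> * T / 2) * (\<sigma> powi k * z (k * int p + m))
      + \<sigma> powi (k - 1) * z ((k - 1) * int p + m) = 0"
    unfolding idx j_def[symmetric] by (simp add: rel)
qed

text \<open>
  The double-angle formula \<open>cos 2t = 2 cos\<^sup>2 t - 1\<close> for the parameter. It comes from adding the
  equations at \<open>2 k + 1\<close> and \<open>2 k - 1\<close> and eliminating the odd terms with the one at \<open>2 k\<close>.
\<close>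

lemma chebyshev_double:
  assumes "solves_chebyshev q v"
  shows "solves_chebyshev (2 * q\<^sup>2 - 1) (\<lambda>k. v (2 * k))"
  unfolding solves_chebyshev_def
proof
  fix k
  have cheb: "v (i + 1) - 2 * q * v i + v (i - 1) = 0" for i
    using assms unfolding solves_chebyshev_def by blast
  have up: "v (2 * (k + 1)) = 2 * q * v (2 * k + 1) - v (2 * k)"
    using cheb[of "2 * k + 1"] by (simp add: algebra_simps)
  have down: "v (2 * (k - 1)) = 2 * q * v (2 * k - 1) - v (2 * k)"
    using cheb[of "2 * k - 1"] by (simp add: algebra_simps)
  have mid: "v (2 * k + 1) = 2 * q * v (2 * k) - v (2 * k - 1)"
    using cheb[of "2 * k"] by (simp add: algebra_simps)
  show "v (2 * (k + 1)) - 2 * (2 * q\<^sup>2 - 1) * v (2 * k) + v (2 * (k - 1)) = 0"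
    unfolding up down mid by (simp add: algebra_simps power2_eq_square)
qed

section \<open>Reality and the factorization of subsequences\<close>

lemma powi_in_Reals:
  fixes x :: complex
  assumes "x \<in> \<real>"
  shows "x powi n \<in> \<real>"
  using assms by (auto simp: power_int_def intro!: Reals_power Reals_inverse)

lemma Reals_if_square_positive:
  fixes x y :: complex
  assumes "x\<^sup>2 = y" "y \<in> \<real>" "Re y > 0"
  shows "x \<in> \<real>"
proof -
  have "y = (complex_of_real (sqrt (Re y)))\<^sup>2"
    using assms(2,3) by (simp flip: of_real_power)
  then have "x = of_real (sqrt (Re y)) \<or> x = - of_real (sqrt (Re y))"
    using assms(1) power2_eq_iff by metis
  then show ?thesis
    by auto
qed

theorem theorem3p3:
  fixes K :: "complex set" and p :: nat and r s \<sigma> \<gamma> :: complex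
    and a b c :: "int \<Rightarrow> complex"
  assumes K: "K = \<real> \<or> K = UNIV"
    and p: "p \<ge> 1"
    and r: "r \<in> K - {0}"
    and a: "a \<in> ell_qp (K - {0}) p r"
    and c: "c \<in> ell_qp (K - {0}) p r"
    and b: "b \<in> ell_qp K p r"
    and s: "s = (\<Prod>j = 0..<p. a (int j) / c (int j))"
    and \<sigma>: "\<sigma>\<^sup>2 = r * s"
    and \<gamma>: "\<gamma> = inverse \<sigma>"
  shows "\<exists>q :: complex.
    (\<forall>z \<in> ell K. solves_recurrence a b c z \<longrightarrow>
      (\<forall>m :: int. \<exists>v :: int \<Rightarrow> complex.
        (\<forall>k. subsequence z p m k = \<gamma> powi k * v k) \<and>
        solves_chebyshev q v \<and>
        (K = \<real> \<and> Re (r * s) > 0 \<longrightarrow> v \<in> ell \<real>))) \<and>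
    (K = \<real> \<and> Re (r * s) > 0 \<longrightarrow> q \<in> \<real>) \<and>
    (K = \<real> \<and> Re (r * s) < 0 \<longrightarrow>
      q\<^sup>2 \<in> \<real> \<and>
      (\<forall>z \<in> ell K. solves_recurrence a b c z \<longrightarrow>
        (\<forall>m :: int. \<exists>u \<in> ell \<real>.
          (\<forall>k. subsequence z (2 * p) m k = (r * s) powi (- k) * u k) \<and>
          solves_chebyshev (2 * q\<^sup>2 - 1) u)))"
proof -
  have nz: "\<And>k. a k \<noteq> 0" "\<And>k. c k \<noteq> 0" "r \<noteq> 0"
    using a c r by (auto simp: ell_qp_def ell_def)
  define T D where "T = monodromy_trace a b c p" and "D = casoratian a b c p"
  define q where "q = \<sigma> * T / 2"
  define v where "v z m = (\<lambda>k. \<sigma> powi k * z (k * int p + m))" for z :: "int \<Rightarrow> complex" and m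
  have D: "\<sigma>\<^sup>2 * D = 1"
    using casoratian_period[OF a nz, where b = b] by (simp add: D_def \<sigma> s)
  then have \<sigma>0: "\<sigma> \<noteq> 0"
    by auto
  have cheb: "solves_chebyshev q (v z m)" if "solves_recurrence a b c z" for z m
    unfolding q_def v_def
    by (rule rescaled_chebyshev[OF _ D])
       (use period_shift_relation[OF that a b c nz] in \<open>simp add: T_def D_def\<close>)
  have sub: "subsequence z p m k = \<gamma> powi k * v z m k" for z m k
    using \<sigma>0 by (simp add: subsequence_def v_def \<gamma> power_int_inverse)
  have sub2: "subsequence z (2 * p) m k = (r * s) powi (- k) * v z m (2 * k)" for z m k
  proof -
    have "(r * s) powi (- k) * \<sigma> powi (2 * k) = 1"
      using \<sigma>0 by (simp add: power_int_minus power_int_mult flip: \<sigma>)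
    then show ?thesis
      by (simp add: subsequence_def v_def algebra_simps)
  qed
  have real: "T \<in> \<real>" "r * s \<in> \<real>" if "K = \<real>"
  proof -
    have "a k \<in> \<real>" "b k \<in> \<real>" "c k \<in> \<real>" for k
      using a b c that by (auto simp: ell_qp_def ell_def)
    then show "T \<in> \<real>" "r * s \<in> \<real>"
      using r that unfolding T_def monodromy_trace_def s
      by (auto intro!: Reals_add Reals_mult Reals_divide prod_in_Reals forward_sol_real)
  qed
  have \<sigma>_real: "\<sigma> \<in> \<real>" if "K = \<real> \<and> Re (r * s) > 0"
    using Reals_if_square_positive[OF \<sigma>] real that by blast
  show ?thesis
  proof (intro exI[of _ q] conjI impI ballI allI)
    fix z m
    assume z: "z \<in> ell K" "solves_recurrence a b c z"
    have "v z m \<in> ell \<real>" if "K = \<real> \<and> Re (r * s) > 0"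
      using \<sigma>_real[OF that] z(1) that by (auto simp: ell_def v_def intro!: Reals_mult powi_in_Reals)
    then show "\<exists>v. (\<forall>k. subsequence z p m k = \<gamma> powi k * v k) \<and> solves_chebyshev q v \<and>
        (K = \<real> \<and> Re (r * s) > 0 \<longrightarrow> v \<in> ell \<real>)"
      using sub cheb[OF z(2)] by blast
  next
    assume "K = \<real> \<and> Re (r * s) > 0"
    then show "q \<in> \<real>"
      using \<sigma>_real real by (auto simp: q_def intro!: Reals_mult Reals_divide)
  next
    assume neg: "K = \<real> \<and> Re (r * s) < 0"
    have "q\<^sup>2 = r * s * T\<^sup>2 / 4"
      by (simp add: q_def power_mult_distrib power_divide \<sigma>)
    moreover have "r * s * T\<^sup>2 \<in> \<real>"
      using neg by (intro Reals_mult[OF real(2)] Reals_power real(1)) auto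
    ultimately show "q\<^sup>2 \<in> \<real>"
      by (simp only: Reals_divide Reals_numeral)
    fix z m
    assume z: "z \<in> ell K" "solves_recurrence a b c z"
    have "\<sigma> powi (2 * k) \<in> \<real>" for k
      using real neg by (simp add: power_int_mult \<sigma> powi_in_Reals)
    then have "(\<lambda>k. v z m (2 * k)) \<in> ell \<real>"
      using z(1) neg by (auto simp: ell_def v_def intro!: Reals_mult)
    then show "\<exists>u \<in> ell \<real>. (\<forall>k. subsequence z (2 * p) m k = (r * s) powi (- k) * u k) \<and>
        solves_chebyshev (2 * q\<^sup>2 - 1) u"
      by (rule bexI[rotated]) (use sub2 chebyshev_double[OF cheb[OF z(2)]] in simp)
  qed
qed

end
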